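(* For $n\ge 3$, the number of edges of the polytope $\mathsf{DP(n)}$ is $2^{n-2}(2n-3)$.
   Context: $\mathsf{DP(n)}$ is the convex hull in $\mathbb{R}^n$ of all degree partitions (degree sequences sorted in weakly decreasing order, zeros allowed) of simple graphs on vertex set $[n]$. *)

theory Defs
  imports "HOL-Analysis.Analysis"
begin

text \<open>
  The vertex set \<open>[n]\<close> and the coordinates of \<open>\<real>\<^sup>n\<close> are both indexed by a
  finite linearly ordered type \<open>'n\<close> with \<open>n\<close> elements; the order on \<open>'n\<close> plays the
  role of \<open>1 < 2 < \<dots> < n\<close>.
\<close>

definition simple_graph :: "'v set \<Rightarrow> 'v set set \<Rightarrow> bool" where
  "simple_graph V E \<longleftrightarrow> finite V \<and> (\<forall>e\<in>E. e \<subseteq> V \<and> card e = 2)"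

definition vertex_degree :: "'v set set \<Rightarrow> 'v \<Rightarrow> nat" where
  "vertex_degree E v = card {e \<in> E. v \<in> e}"

text \<open>
  The bijection \<open>\<pi>\<close> sorts the degree sequence: a degree partition is a weakly decreasing
  rearrangement of the degrees of some graph.
\<close>

definition degree_partitions :: "(real ^ 'n::{finite,linorder}) set" where
  "degree_partitions =
    {d. antimono (\<lambda>i. d $ i) \<and>
        (\<exists>E \<pi>. simple_graph (UNIV :: 'n set) E \<and> bij \<pi> \<and>
               (\<forall>i. d $ i = real (vertex_degree E (\<pi> i))))}"

definition DP :: "(real ^ 'n::{finite,linorder}) set" where
  "DP = convex hull degree_partitions"

end

theory Submission
  imports Defs
begin

text \<open>
  For real weights \<open>a\<close>, the degree vectors maximising \<open>x \<mapsto> a \<bullet> x\<close> are those of the graphs that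
  contain every pair with \<open>a\<^sub>i + a\<^sub>j > 0\<close> and no pair with \<open>a\<^sub>i + a\<^sub>j < 0\<close>; the
  pairs with \<open>a\<^sub>i + a\<^sub>j = 0\<close> are free, and they are grouped by the level \<open>\<bar>a\<^sub>i\<bar>\<close>.
  On weakly decreasing vectors a functional \<open>c\<close> may be replaced by its projection \<open>a\<close> onto the
  cone of decreasing vectors, so every nonempty face of \<open>DP\<close> contains the two
  threshold partitions obtained by rejecting or accepting all free pairs of a decreasing \<open>a\<close>. The
  levels with free pairs can be switched independently, so an edge has exactly one such level, and it
  is the segment between these two partitions. Conversely each such segment is an edge: penalising
  \<open>x\<^sub>i - x\<^sub>j\<close> for \<open>i < j\<close>, \<open>a\<^sub>i = a\<^sub>j\<close> forces an optimal \<open>x\<close> to be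
  constant on the level sets of \<open>a\<close>.

  It remains to count the pairs of end points. Let \<open>E\<^sub>n\<close> be their number. If the first and the last
  weight do not cancel, then the first vertex is dominating or the last one is isolated and it can be
  removed, which yields \<open>2 E\<^sub>n\<^sub>-\<^sub>1\<close> pairs. If they cancel, they lie on the free
  level, which consists either of all vertices or of \<open>p\<close> first and \<open>q\<close> last ones around an
  arbitrary threshold partition; there are \<open>2\<^sup>n\<^sup>-\<^sup>1\<close> of these, so that
  \<open>E\<^sub>n = 2 E\<^sub>n\<^sub>-\<^sub>1 + 2\<^sup>n\<^sup>-\<^sup>1\<close>.
\<close>

section \<open>Faces of the polytope of degree partitions\<close>

text \<open>The set \<open>L\<close> consists of the levels whose free pairs are accepted.\<close>

definition threshold_adj :: "real^'n::finite \<Rightarrow> real set \<Rightarrow> 'n \<Rightarrow> 'n \<Rightarrow> bool" where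
  "threshold_adj a L i j \<longleftrightarrow> i \<noteq> j \<and> (a $ i + a $ j > 0 \<or> (a $ i + a $ j = 0 \<and> \<bar>a $ i\<bar> \<in> L))"

definition threshold_degrees :: "real^'n::finite \<Rightarrow> real set \<Rightarrow> real^'n" where
  "threshold_degrees a L = (\<chi> i. real (card {j. threshold_adj a L i j}))"

definition resonance :: "real^'n::finite \<Rightarrow> real set" where
  "resonance a = {\<bar>a $ i\<bar> | i j. i \<noteq> j \<and> a $ i + a $ j = 0}"

text \<open>A convex relaxation of the set of degree vectors by edge weights in \<open>[0, 1]\<close>.\<close>

definition fractional_degrees :: "(real^'n::finite) set" where
  "fractional_degrees = {x. \<exists>e :: 'n \<Rightarrow> 'n \<Rightarrow> real.
     (\<forall>i j. 0 \<le> e i j \<and> e i j \<le> 1 \<and> e i j = e j i) \<and> (\<forall>i. e i i = 0) \<and>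
     (\<forall>i. x $ i = (\<Sum>j\<in>UNIV. e i j))}"

section \<open>Degree partitions and their fractional relaxation\<close>

lemma degree_partitionsI:
  fixes d :: "real^'n::{finite,linorder}"
  assumes "antimono (\<lambda>i. d $ i)" and sym: "\<And>i j. r i j \<Longrightarrow> r j i" and irr: "\<And>i. \<not> r i i"
    and d: "\<And>i. d $ i = real (card {j. r i j})"
  shows "d \<in> degree_partitions"
proof -
  define E where "E = {{i, j} | i j. r i j}"
  have g: "simple_graph UNIV E"
    using irr by (auto simp: simple_graph_def E_def card_2_iff) metis
  have "vertex_degree E v = card {j. r v j}" for v
  proof -
    have "{e \<in> E. v \<in> e} = (\<lambda>j. {v, j}) ` {j. r v j}"
      using sym by (auto simp: E_def insert_commute)
    moreover have "inj_on (\<lambda>j. {v, j}) {j. r v j}"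
      by (auto simp: inj_on_def doubleton_eq_iff)
    ultimately show ?thesis
      by (simp add: vertex_degree_def card_image)
  qed
  then show ?thesis
    unfolding degree_partitions_def using g d
    by (intro CollectI conjI exI[of _ E] exI[of _ id] assms(1)) auto
qed

lemma degree_partitions_antimono: "x \<in> degree_partitions \<Longrightarrow> antimono (\<lambda>i. x $ i)"
  by (simp add: degree_partitions_def)

lemma degree_partitions_subset_fractional:
  "(degree_partitions :: (real^'n::{finite,linorder}) set) \<subseteq> fractional_degrees"
proof
  fix d :: "real^'n::{finite,linorder}" assume "d \<in> degree_partitions"
  then obtain E :: "'n set set" and \<pi> where g: "simple_graph UNIV E" and b: "bij \<pi>"
    and d: "\<And>i. d $ i = real (vertex_degree E (\<pi> i))"
    by (auto simp: degree_partitions_def)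
  \<comment> \<open>The graph is pulled back along \<open>\<pi>\<close>, which makes the rearranged
    degrees the row sums of a symmetric weight.\<close>
  define e :: "'n \<Rightarrow> 'n \<Rightarrow> real" where "e i j = of_bool (i \<noteq> j \<and> {\<pi> i, \<pi> j} \<in> E)" for i j
  have inj: "\<pi> i = \<pi> j \<longleftrightarrow> i = j" for i j
    using b by (auto simp: bij_def inj_def)
  have "d $ i = (\<Sum>j\<in>UNIV. e i j)" for i
  proof -
    have "{s \<in> E. \<pi> i \<in> s} = (\<lambda>j. {\<pi> i, \<pi> j}) ` {j. i \<noteq> j \<and> {\<pi> i, \<pi> j} \<in> E}"
    proof -
      have "\<exists>j. i \<noteq> j \<and> s = {\<pi> i, \<pi> j}" if s: "s \<in> E" "\<pi> i \<in> s" for s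
      proof -
        have "card s = 2" using g s by (auto simp: simple_graph_def)
        then obtain v where "s = {\<pi> i, v}" "v \<noteq> \<pi> i"
          using s(2) by (auto simp: card_2_iff)
        moreover obtain j where "v = \<pi> j" using b by (meson bij_pointE)
        ultimately show ?thesis by auto
      qed
      then show ?thesis by auto
    qed
    moreover have "inj_on (\<lambda>j. {\<pi> i, \<pi> j}) {j. i \<noteq> j \<and> {\<pi> i, \<pi> j} \<in> E}"
      by (auto simp: inj_on_def doubleton_eq_iff inj)
    ultimately have "vertex_degree E (\<pi> i) = card {j. i \<noteq> j \<and> {\<pi> i, \<pi> j} \<in> E}"
      by (simp add: vertex_degree_def card_image)
    then show ?thesis
      by (simp add: d e_def)
  qed
  moreover have "\<forall>i j. 0 \<le> e i j \<and> e i j \<le> 1 \<and> e i j = e j i" "\<forall>i. e i i = 0"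
    by (auto simp: e_def insert_commute)
  ultimately show "d \<in> fractional_degrees"
    unfolding fractional_degrees_def by blast
qed

lemma finite_degree_partitions: "finite (degree_partitions :: (real^'n::{finite,linorder}) set)"
proof (rule finite_subset)
  show "degree_partitions \<subseteq> range (\<lambda>(E :: 'n set set, \<pi> :: 'n \<Rightarrow> 'n). \<chi> i. real (vertex_degree E (\<pi> i)))"
  proof
    fix d :: "real^'n::{finite,linorder}" assume "d \<in> degree_partitions"
    then obtain E :: "'n set set" and \<pi> where "\<And>i. d $ i = real (vertex_degree E (\<pi> i))"
      by (auto simp: degree_partitions_def)
    then have "d = (\<lambda>(E, \<pi>). \<chi> i. real (vertex_degree E (\<pi> i))) (E, \<pi>)"
      by (simp add: vec_eq_iff)
    then show "d \<in> range (\<lambda>(E :: 'n set set, \<pi> :: 'n \<Rightarrow> 'n). \<chi> i. real (vertex_degree E (\<pi> i)))"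
      by blast
  qed
qed simp

lemma convex_fractional_degrees: "convex fractional_degrees"
proof (rule convexI)
  fix x y :: "real^'n" and u v :: real
  assume "x \<in> fractional_degrees" "y \<in> fractional_degrees" and uv: "0 \<le> u" "0 \<le> v" "u + v = 1"
  then obtain e f where
    e: "\<forall>i j. 0 \<le> e i j \<and> e i j \<le> 1 \<and> e i j = e j i" "\<forall>i. e i i = (0::real)" "\<forall>i. x $ i = (\<Sum>j\<in>UNIV. e i j)"
    and f: "\<forall>i j. 0 \<le> f i j \<and> f i j \<le> 1 \<and> f i j = f j i" "\<forall>i. f i i = (0::real)" "\<forall>i. y $ i = (\<Sum>j\<in>UNIV. f i j)"
    unfolding fractional_degrees_def by blast
  let ?h = "\<lambda>i j. u * e i j + v * f i j"
  have "\<forall>i j. 0 \<le> ?h i j \<and> ?h i j \<le> 1 \<and> ?h i j = ?h j i"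
    using e(1) f(1) uv by (auto intro!: convex_bound_le)
  moreover have "\<forall>i. (u *\<^sub>R x + v *\<^sub>R y) $ i = (\<Sum>j\<in>UNIV. ?h i j)"
    using e f by (simp add: sum.distrib sum_distrib_left)
  ultimately show "u *\<^sub>R x + v *\<^sub>R y \<in> fractional_degrees"
    unfolding fractional_degrees_def using e(2) f(2) by (intro CollectI exI[of _ ?h]) auto
qed

lemma convex_antimono: "convex {x :: real^'n::{finite,linorder}. antimono (\<lambda>i. x $ i)}"
  by (rule convexI) (auto simp: monotone_on_def intro!: add_mono mult_left_mono)

lemma closed_antimono: "closed {x :: real^'n::{finite,linorder}. antimono (\<lambda>i. x $ i)}"
proof -
  have "{x :: real^'n::{finite,linorder}. antimono (\<lambda>i. x $ i)} = (\<Inter>(i, j)\<in>{(i, j). i \<le> j}. {x. x $ j \<le> x $ i})"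
    by (auto simp: monotone_on_def)
  then show ?thesis
    by (simp only:) (intro closed_INT ballI, auto intro!: closed_Collect_le continuous_on_component continuous_on_id)
qed

lemma DP_antimono: "x \<in> DP \<Longrightarrow> antimono (\<lambda>i. x $ i)"
  using hull_minimal[of degree_partitions _ convex, OF _ convex_antimono] degree_partitions_antimono
  unfolding DP_def by blast

lemma DP_fractional: "x \<in> DP \<Longrightarrow> x \<in> fractional_degrees"
  using hull_minimal[of degree_partitions _ convex, OF degree_partitions_subset_fractional convex_fractional_degrees]
  unfolding DP_def by blast

section \<open>Threshold graphs as maximisers of linear functionals\<close>

lemma threshold_adj_sym: "threshold_adj a L i j \<Longrightarrow> threshold_adj a L j i"
proof -
  have "\<bar>y\<bar> = \<bar>x\<bar>" if "x + y = 0" for x y :: real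
    using that by linarith
  then show "threshold_adj a L i j \<Longrightarrow> threshold_adj a L j i"
    unfolding threshold_adj_def by (metis add.commute)
qed

lemma threshold_adj_commute: "threshold_adj a L i j \<longleftrightarrow> threshold_adj a L j i"
  using threshold_adj_sym by blast

lemma threshold_degrees_sum: "threshold_degrees a L $ i = (\<Sum>j\<in>UNIV. of_bool (threshold_adj a L i j))"
  by (simp add: threshold_degrees_def)

lemma threshold_degrees_fractional: "threshold_degrees a L \<in> fractional_degrees"
proof -
  have "of_bool (threshold_adj a L i j) = (of_bool (threshold_adj a L j i) :: real)" for i j
    by (subst threshold_adj_commute) simp
  then show ?thesis
    unfolding fractional_degrees_def
    by (intro CollectI exI[of _ "\<lambda>i j. of_bool (threshold_adj a L i j)"]) (auto simp: threshold_degrees_def, auto simp: threshold_adj_def)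
qed

text \<open>Each edge weight is counted at both of its ends, so a functional on degrees becomes one
  on pairs with coefficients \<open>a $ i + a $ j\<close>; the factor 2 comes from summing over
  ordered pairs.\<close>

lemma inner_symmetric_sum:
  fixes a x :: "real^'n::finite"
  assumes "\<forall>i j. e i j = e j i" "\<forall>i. x $ i = (\<Sum>j\<in>UNIV. e i j)"
  shows "2 * (a \<bullet> x) = (\<Sum>i\<in>UNIV. \<Sum>j\<in>UNIV. (a $ i + a $ j) * e i j)"
proof -
  have 1: "a \<bullet> x = (\<Sum>i\<in>UNIV. \<Sum>j\<in>UNIV. a $ i * e i j)"
    using assms(2) by (simp add: inner_vec_def sum_distrib_left)
  also have "\<dots> = (\<Sum>j\<in>UNIV. \<Sum>i\<in>UNIV. a $ i * e i j)"
    by (rule sum.swap)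
  also have "\<dots> = (\<Sum>i\<in>UNIV. \<Sum>j\<in>UNIV. a $ j * e i j)"
    using assms(1) by (auto intro!: sum.cong)
  finally show ?thesis
    using 1 by (simp add: sum.distrib distrib_right)
qed

text \<open>Written over pairs, the objective is maximised separately on each pair: weight 1 if
  \<open>a $ i + a $ j\<close> is positive, 0 if negative, anything if zero. At equality every pair
  is optimal, so only the free pairs may vary and \<open>x\<close> is squeezed between rejecting and
  accepting all of them.\<close>

lemma threshold_degrees_optimal:
  assumes "x \<in> fractional_degrees"
  shows "a \<bullet> x \<le> a \<bullet> threshold_degrees a L"
    and "a \<bullet> x = a \<bullet> threshold_degrees a L \<Longrightarrow> threshold_degrees a {} \<le> x \<and> x \<le> threshold_degrees a UNIV"
proof -
  obtain e where e: "\<forall>i j. 0 \<le> e i j \<and> e i j \<le> 1 \<and> e i j = e j i" "\<forall>i. e i i = (0::real)" "\<forall>i. x $ i = (\<Sum>j\<in>UNIV. e i j)"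
    using assms unfolding fractional_degrees_def by blast
  \<comment> \<open>\<open>t i j\<close> is the loss of \<open>e\<close> against the threshold graph
    on one pair.\<close>
  define t where "t i j = (a $ i + a $ j) * (of_bool (threshold_adj a L i j) - e i j)" for i j
  have t0: "t i j \<ge> 0" for i j
    using e(1)[rule_format, of i j] e(2)
    by (cases "a $ i + a $ j" "0::real" rule: linorder_cases)
       (auto simp: t_def threshold_adj_def mult_nonpos_nonneg split: if_splits)
  have "2 * (a \<bullet> x) = (\<Sum>i\<in>UNIV. \<Sum>j\<in>UNIV. (a $ i + a $ j) * e i j)"
    using e by (intro inner_symmetric_sum) auto
  moreover have "2 * (a \<bullet> threshold_degrees a L) = (\<Sum>i\<in>UNIV. \<Sum>j\<in>UNIV. (a $ i + a $ j) * of_bool (threshold_adj a L i j))"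
    using threshold_adj_sym by (intro inner_symmetric_sum) (auto simp: threshold_degrees_sum of_bool_def)
  ultimately have eq: "2 * (a \<bullet> threshold_degrees a L - a \<bullet> x) = (\<Sum>i\<in>UNIV. \<Sum>j\<in>UNIV. t i j)"
    by (simp add: t_def right_diff_distrib sum_subtractf)
  then show "a \<bullet> x \<le> a \<bullet> threshold_degrees a L"
    using t0 by (smt (verit) sum_nonneg)
  assume "a \<bullet> x = a \<bullet> threshold_degrees a L"
  with eq have "(\<Sum>i\<in>UNIV. \<Sum>j\<in>UNIV. t i j) = 0" by simp
  then have t: "t i j = 0" for i j
    using t0 by (simp add: sum_nonneg_eq_0_iff sum_nonneg)
  have "of_bool (threshold_adj a {} i j) \<le> e i j \<and> e i j \<le> of_bool (threshold_adj a UNIV i j)" for i j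
    using t[of i j] e(1)[rule_format, of i j] e(2)
    by (auto simp: t_def threshold_adj_def split: if_splits)
  then show "threshold_degrees a {} \<le> x \<and> x \<le> threshold_degrees a UNIV"
    using e(3) by (auto simp: less_eq_vec_def threshold_degrees_sum simp del: sum_of_bool_eq intro!: sum_mono)
qed

lemma threshold_degrees_inner_eq: "a \<bullet> threshold_degrees a L = a \<bullet> threshold_degrees a L'"
  by (meson threshold_degrees_optimal(1) threshold_degrees_fractional order_antisym)

text \<open>A neighbour of \<open>j\<close> other than \<open>i\<close> is also a neighbour of
  \<open>i\<close>, and the pair of \<open>i\<close> and \<open>j\<close> itself contributes equally
  to both.\<close>

lemma threshold_degrees_mono:
  fixes a :: "real^'n::finite"
  assumes "a $ j \<le> a $ i"
  shows "threshold_degrees a L $ j \<le> threshold_degrees a L $ i"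
proof (cases "i = j")
  case False
  have split: "threshold_degrees a L $ k = of_bool (threshold_adj a L i j) + (\<Sum>l\<in>UNIV - {i, j}. of_bool (threshold_adj a L k l))"
    if "k = i \<or> k = j" for k
  proof -
    have "threshold_degrees a L $ k = (\<Sum>l\<in>{i, j}. of_bool (threshold_adj a L k l)) + (\<Sum>l\<in>UNIV - {i, j}. of_bool (threshold_adj a L k l))"
      unfolding threshold_degrees_sum by (subst sum.subset_diff[of "{i, j}"]) (auto simp: add.commute)
    also have "(\<Sum>l\<in>{i, j}. of_bool (threshold_adj a L k l)) = (of_bool (threshold_adj a L i j) :: real)"
      using that False threshold_adj_commute[of a L i j] by (auto simp: threshold_adj_def)
    finally show ?thesis .
  qed
  have "of_bool (threshold_adj a L j l) \<le> (of_bool (threshold_adj a L i l) :: real)" if "l \<in> UNIV - {i, j}" for l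
    using that assms by (cases "a $ i = a $ j") (auto simp: threshold_adj_def)
  then show ?thesis
    using split[of i] split[of j] sum_mono by (smt (verit))
qed simp

lemma threshold_degrees_cong: "a $ i = a $ j \<Longrightarrow> threshold_degrees a L $ i = threshold_degrees a L $ j"
  by (simp add: order_antisym threshold_degrees_mono)

lemma threshold_degrees_degree_partition:
  assumes "antimono (\<lambda>i. a $ i)"
  shows "threshold_degrees a L \<in> degree_partitions"
proof (rule degree_partitionsI[of _ "threshold_adj a L"])
  show "antimono (\<lambda>i. threshold_degrees a L $ i)"
    using assms by (auto simp: monotone_on_def intro: threshold_degrees_mono)
qed (auto intro: threshold_adj_sym, auto simp: threshold_degrees_def threshold_adj_def)

lemma threshold_degrees_in_DP: "antimono (\<lambda>i. a $ i) \<Longrightarrow> threshold_degrees a L \<in> DP"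
  by (simp add: DP_def hull_inc threshold_degrees_degree_partition)

lemma threshold_degrees_le: "threshold_degrees a {} \<le> threshold_degrees a UNIV"
  by (auto simp: less_eq_vec_def threshold_degrees_def threshold_adj_def intro!: card_mono)

lemma threshold_degrees_not_resonant: 
  assumes "\<bar>a $ i\<bar> \<notin> resonance a" shows "threshold_degrees a L $ i = threshold_degrees a L' $ i"
  using assms by (auto simp: threshold_degrees_def threshold_adj_def resonance_def intro!: arg_cong[of _ _ card])

text \<open>All free pairs at \<open>i\<close> lie on the level \<open>\<bar>a $ i\<bar>\<close>, so
  \<open>L\<close> matters there only through this one level.\<close>

lemma threshold_degrees_level:
  "threshold_degrees a L $ i = (if \<bar>a $ i\<bar> \<in> L then threshold_degrees a UNIV $ i else threshold_degrees a {} $ i)"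
  by (auto simp: threshold_degrees_def threshold_adj_def intro!: arg_cong[of _ _ card])

lemma threshold_degrees_resonant:
  assumes "\<bar>a $ i\<bar> \<in> resonance a" shows "threshold_degrees a {} $ i < threshold_degrees a UNIV $ i"
proof -
  obtain k l where kl: "\<bar>a $ i\<bar> = \<bar>a $ k\<bar>" "k \<noteq> l" "a $ k + a $ l = 0"
    using assms by (auto simp: resonance_def)
  \<comment> \<open>The weight of \<open>i\<close> is that of \<open>k\<close> or of
    \<open>l\<close>, and the other one is a partner of \<open>i\<close>. If that one is
    \<open>i\<close> itself, the weight is 0 and the first one is taken.\<close>
  obtain j where "j \<noteq> i" "a $ i + a $ j = 0"
  proof (cases "a $ i = a $ k")
    case True
    then show ?thesis
      using kl that[of l] that[of k] by (cases "l = i") auto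
  next
    case False
    then show ?thesis
      using kl that[of k] by (cases "k = i") auto
  qed
  then have "j \<in> {j. threshold_adj a UNIV i j} - {j. threshold_adj a {} i j}"
    by (auto simp: threshold_adj_def)
  moreover have "{j. threshold_adj a {} i j} \<subseteq> {j. threshold_adj a UNIV i j}"
    by (auto simp: threshold_adj_def)
  ultimately have "{j. threshold_adj a {} i j} \<subset> {j. threshold_adj a UNIV i j}" by blast
  then show ?thesis
    by (simp add: threshold_degrees_def psubset_card_mono)
qed

text \<open>
  The third property holds because \<open>a \<plusminus> t x\<close> is still decreasing for small \<open>t\<close> if \<open>x\<close> is constant
  on the level sets of the projection \<open>a\<close> of \<open>c\<close>.
\<close>

lemma closest_antimono:
  fixes c :: "real^'n::{finite,linorder}"
  obtains a where "antimono (\<lambda>i. a $ i)"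
    "\<And>x. antimono (\<lambda>i. x $ i) \<Longrightarrow> c \<bullet> x \<le> a \<bullet> x"
    "\<And>x. (\<And>i j. a $ i = a $ j \<Longrightarrow> x $ i = x $ j) \<Longrightarrow> c \<bullet> x = a \<bullet> x"
proof
  let ?K = "{x :: real^'n::{finite,linorder}. antimono (\<lambda>i. x $ i)}"
  define a where "a = closest_point ?K c"
  have ne: "?K \<noteq> {}"
    by (auto intro!: exI[of _ 0] simp: monotone_on_def)
  have a: "antimono (\<lambda>i. a $ i)"
    using closest_point_in_set[OF closed_antimono ne] by (simp add: a_def)
  have obtuse: "(c - a) \<bullet> (x - a) \<le> 0" if "antimono (\<lambda>i. x $ i)" for x
    unfolding a_def using that by (intro closest_point_dot convex_antimono closed_antimono) auto
  show "antimono (\<lambda>i. a $ i)" by (fact a)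
  \<comment> \<open>The decreasing vectors form a cone, so the obtuse angle criterion for
    projections applies to \<open>a + x\<close>.\<close>
  show "c \<bullet> x \<le> a \<bullet> x" if "antimono (\<lambda>i. x $ i)" for x
    using obtuse[of "a + x"] that a by (auto simp: monotone_on_def inner_diff_left intro!: add_mono)
  show "c \<bullet> x = a \<bullet> x" if x: "\<And>i j. a $ i = a $ j \<Longrightarrow> x $ i = x $ j" for x
  proof -
    \<comment> \<open>The gaps of \<open>a\<close> relative to the size of \<open>x\<close> bound a
      perturbation that keeps \<open>a\<close> decreasing. The summand 1 avoids division by zero,
      and the inserted 1 keeps \<open>A\<close> nonempty.\<close>
    define A where "A = insert 1 {(a $ i - a $ j) / (\<bar>x $ i\<bar> + \<bar>x $ j\<bar> + 1) | i j. a $ j < a $ i}"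
    have "A \<subseteq> insert 1 ((\<lambda>(i, j). (a $ i - a $ j) / (\<bar>x $ i\<bar> + \<bar>x $ j\<bar> + 1)) ` UNIV)"
      by (auto simp: A_def)
    then have fin: "finite A" by (rule finite_subset) simp
    define t where "t = Min A"
    have "\<forall>s\<in>A. 0 < s"
      by (auto simp: A_def intro!: divide_pos_pos add_nonneg_pos)
    then have t: "t > 0"
      using fin Min_in[of A] by (auto simp: t_def A_def)
    have small: "t * (\<bar>x $ i\<bar> + \<bar>x $ j\<bar>) \<le> a $ i - a $ j" if "a $ j < a $ i" for i j
    proof -
      have "t \<le> (a $ i - a $ j) / (\<bar>x $ i\<bar> + \<bar>x $ j\<bar> + 1)"
        unfolding t_def using that fin by (intro Min_le) (auto simp: A_def)
      then have "t * (\<bar>x $ i\<bar> + \<bar>x $ j\<bar> + 1) \<le> a $ i - a $ j"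
        by (simp add: field_simps)
      then show ?thesis using t by (simp add: distrib_left)
    qed
    have mono: "antimono (\<lambda>i. (a + s *\<^sub>R x) $ i)" if "\<bar>s\<bar> = t" for s
    proof (rule monotoneI)
      fix i j :: 'n assume "i \<le> j"
      then have "a $ j \<le> a $ i" using a by (auto simp: monotone_on_def)
      moreover have "\<bar>s * x $ i\<bar> + \<bar>s * x $ j\<bar> = t * (\<bar>x $ i\<bar> + \<bar>x $ j\<bar>)"
        using that by (simp add: abs_mult distrib_left)
      ultimately have "a $ j + s * x $ j \<le> a $ i + s * x $ i"
        using small[of j i] x[of i j] by (cases "a $ i = a $ j") (simp, linarith)
      then show "(a + s *\<^sub>R x) $ j \<le> (a + s *\<^sub>R x) $ i" by simp
    qed
    \<comment> \<open>Moving from \<open>a\<close> in both directions turns the criterion into an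
      equality.\<close>
    have "t * ((c - a) \<bullet> x) \<le> 0" "- t * ((c - a) \<bullet> x) \<le> 0"
      using obtuse[OF mono[of t]] obtuse[OF mono[of "- t"]] t by simp_all
    then show ?thesis
      using t by (simp add: mult_le_0_iff zero_le_mult_iff inner_diff_left)
  qed
qed

section \<open>Edges as segments between threshold partitions\<close>

text \<open>At a coordinate on the level \<open>v\<close> the two ends differ strictly, and the
  bounds on \<open>x\<close> there force \<open>t\<close> into the unit interval.\<close>

lemma closed_segment_resonance:
  fixes a :: "real^'n::finite"
  assumes "resonance a = {v}" "x - threshold_degrees a {} = t *\<^sub>R (threshold_degrees a UNIV - threshold_degrees a {})"
    "threshold_degrees a {} \<le> x" "x \<le> threshold_degrees a UNIV"
  shows "x \<in> closed_segment (threshold_degrees a {}) (threshold_degrees a UNIV)"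
proof -
  have "v \<in> resonance a" using assms(1) by simp
  then obtain i where i: "\<bar>a $ i\<bar> \<in> resonance a"
    unfolding resonance_def by blast
  let ?g = "threshold_degrees a UNIV $ i - threshold_degrees a {} $ i"
  have g: "?g > 0" using threshold_degrees_resonant[OF i] by simp
  have "x $ i - threshold_degrees a {} $ i = t * ?g"
    using arg_cong[OF assms(2), of "\<lambda>y. y $ i"] by simp
  moreover have "threshold_degrees a {} $ i \<le> x $ i" "x $ i \<le> threshold_degrees a UNIV $ i"
    using assms(3,4) by (auto simp: less_eq_vec_def)
  ultimately have "0 \<le> t * ?g" "t * ?g \<le> ?g" by linarith+
  then have "0 \<le> t" "t \<le> 1"
    using g by (auto simp: zero_le_mult_iff mult_le_cancel_right1)
  moreover have "x = (1 - t) *\<^sub>R threshold_degrees a {} + t *\<^sub>R threshold_degrees a UNIV"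
    using assms(2) by (simp add: algebra_simps)
  ultimately show ?thesis by (auto simp: in_segment)
qed

text \<open>The exposing functional \<open>c\<close> is traded for its projection \<open>a\<close>.
  The face then contains \<open>threshold_degrees a L\<close> for every \<open>L\<close>, and being
  one-dimensional it leaves room for only one level.\<close>

lemma edge_imp_resonance:
  fixes F :: "(real^'n::{finite,linorder}) set"
  assumes "F edge_of DP"
  obtains a v where "antimono (\<lambda>i. a $ i)" "resonance a = {v}"
    "F = closed_segment (threshold_degrees a {}) (threshold_degrees a UNIV)"
proof -
  have F: "F face_of DP" and dim: "aff_dim F = 1"
    using assms by (auto simp: edge_of_def)
  have "polyhedron (DP :: (real^'n::{finite,linorder}) set)"
    by (simp add: DP_def finite_degree_partitions polytope_convex_hull polytope_imp_polyhedron)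
  then have "F exposed_face_of DP"
    using F exposed_face_of_polyhedron by blast
  then obtain c b where cb: "DP \<subseteq> {x. c \<bullet> x \<le> b}" "F = DP \<inter> {x. c \<bullet> x = b}"
    by (auto simp: exposed_face_of_def)
  obtain a where a: "antimono (\<lambda>i. a $ i)"
    and le: "\<And>x. antimono (\<lambda>i. x $ i) \<Longrightarrow> c \<bullet> x \<le> a \<bullet> x"
    and eq: "\<And>x. (\<And>i j. a $ i = a $ j \<Longrightarrow> x $ i = x $ j) \<Longrightarrow> c \<bullet> x = a \<bullet> x"
    using closest_antimono by blast
  \<comment> \<open>Threshold degrees are constant on the level sets of \<open>a\<close>, and on
    such vectors \<open>c\<close> and \<open>a\<close> agree.\<close>
  have thr_c: "c \<bullet> threshold_degrees a L = a \<bullet> threshold_degrees a {}" for L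
    using eq[of "threshold_degrees a L"] threshold_degrees_cong threshold_degrees_inner_eq by metis
  have "F \<noteq> {}" using dim by force
  then obtain y where y: "y \<in> DP" "c \<bullet> y = b" using cb(2) by auto
  have "b \<le> a \<bullet> threshold_degrees a {}"
    using y le[OF DP_antimono] threshold_degrees_optimal(1)[OF DP_fractional] by (metis order_trans)
  moreover have "a \<bullet> threshold_degrees a {} \<le> b"
    using cb(1) threshold_degrees_in_DP[OF a, of "{}"] thr_c[of "{}"] by auto
  ultimately have b: "b = a \<bullet> threshold_degrees a {}" by simp
  have thr_F: "threshold_degrees a L \<in> F" for L
    using threshold_degrees_in_DP[OF a] thr_c b cb(2) by auto
  \<comment> \<open>On the face, \<open>b = c \<bullet> x \<le> a \<bullet> x \<le> b\<close>, so
    \<open>x\<close> is optimal for \<open>a\<close> as well.\<close>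
  have between: "threshold_degrees a {} \<le> x \<and> x \<le> threshold_degrees a UNIV" if "x \<in> F" for x
  proof (rule threshold_degrees_optimal(2)[of _ _ "{}"])
    have x: "x \<in> DP" "c \<bullet> x = b" using that cb(2) by auto
    show "x \<in> fractional_degrees" using x(1) by (rule DP_fractional)
    then show "a \<bullet> x = a \<bullet> threshold_degrees a {}"
      using x le[OF DP_antimono[OF x(1)]] threshold_degrees_optimal(1)[of x a "{}"] b by simp
  qed
  have ne: "threshold_degrees a {} \<noteq> threshold_degrees a UNIV"
  proof
    assume "threshold_degrees a {} = threshold_degrees a UNIV"
    then have "F \<subseteq> {threshold_degrees a {}}" using between by (metis order_antisym singletonI subsetI)
    then show False using dim aff_dim_subset[of F "{threshold_degrees a {}}"] by simp
  qed
  have line: "\<exists>t. x - threshold_degrees a {} = t *\<^sub>R (threshold_degrees a UNIV - threshold_degrees a {})" if x: "x \<in> F" for x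
  proof -
    have "collinear F" using dim by (simp add: collinear_aff_dim)
    then obtain u where u: "\<And>x y. x \<in> F \<Longrightarrow> y \<in> F \<Longrightarrow> \<exists>r. x - y = r *\<^sub>R u"
      unfolding collinear_def by blast
    obtain r where r: "threshold_degrees a UNIV - threshold_degrees a {} = r *\<^sub>R u" using u[OF thr_F thr_F] by blast
    obtain s where s: "x - threshold_degrees a {} = s *\<^sub>R u" using u[OF x thr_F] by blast
    have "r \<noteq> 0" using r ne by auto
    then have "x - threshold_degrees a {} = (s / r) *\<^sub>R (threshold_degrees a UNIV - threshold_degrees a {})" using r s by simp
    then show ?thesis by blast
  qed
  have "\<exists>v. v \<in> resonance a"
  proof (rule ccontr)
    assume "\<nexists>v. v \<in> resonance a"
    then have "threshold_degrees a {} = threshold_degrees a UNIV"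
      unfolding vec_eq_iff by (intro allI threshold_degrees_not_resonant) blast
    then show False using ne by simp
  qed
  then obtain v where v: "v \<in> resonance a" by blast
  have "w = v" if w: "w \<in> resonance a" for w
  proof (rule ccontr)
    assume "w \<noteq> v"
    obtain i j where ij: "v = \<bar>a $ i\<bar>" "w = \<bar>a $ j\<bar>"
      using v w by (auto simp: resonance_def)
    \<comment> \<open>Accepting only the level \<open>v\<close> changes coordinate \<open>i\<close>
      fully and coordinate \<open>j\<close> not at all, which would force both \<open>t = 1\<close>
      and \<open>t = 0\<close>.\<close>
    obtain t where t: "threshold_degrees a {v} - threshold_degrees a {} = t *\<^sub>R (threshold_degrees a UNIV - threshold_degrees a {})"
      using line thr_F by blast
    have "threshold_degrees a UNIV $ i - threshold_degrees a {} $ i = t * (threshold_degrees a UNIV $ i - threshold_degrees a {} $ i)"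
      using arg_cong[OF t, of "\<lambda>y. y $ i"] ij by (simp add: threshold_degrees_level[of a "{\<bar>a $ i\<bar>}"])
    then have "t = 1" using threshold_degrees_resonant[of a i] v ij by simp
    moreover have "0 = t * (threshold_degrees a UNIV $ j - threshold_degrees a {} $ j)"
      using arg_cong[OF t, of "\<lambda>y. y $ j"] ij \<open>w \<noteq> v\<close> by (simp add: threshold_degrees_level[of a "{\<bar>a $ i\<bar>}"])
    ultimately show False using threshold_degrees_resonant[of a j] w ij by simp
  qed
  then have res: "resonance a = {v}" using v by blast
  have "F = closed_segment (threshold_degrees a {}) (threshold_degrees a UNIV)"
  proof
    show "F \<subseteq> closed_segment (threshold_degrees a {}) (threshold_degrees a UNIV)"
      using line between closed_segment_resonance[OF res] by blast
    have "convex F" using F by (simp add: face_of_imp_convex)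
    then show "closed_segment (threshold_degrees a {}) (threshold_degrees a UNIV) \<subseteq> F"
      by (simp add: closed_segment_subset thr_F)
  qed
  with a res that show thesis by blast
qed

text \<open>The functional \<open>a\<close> alone may expose a larger face, since its optimal points
  need not be constant where \<open>a\<close> is. The penalty in \<open>c\<close> is nonnegative on
  decreasing vectors and vanishes on threshold degrees, so the maximum is kept while the optimal
  points become constant on the level sets of \<open>a\<close>.\<close>

lemma resonance_imp_edge:
  fixes a :: "real^'n::{finite,linorder}"
  assumes a: "antimono (\<lambda>i. a $ i)" and res: "resonance a = {v}"
  shows "closed_segment (threshold_degrees a {}) (threshold_degrees a UNIV) edge_of DP"
proof -
  let ?P = "{(i :: 'n, j). i < j \<and> a $ i = a $ j}"
  define c where "c = a - (\<Sum>(i, j)\<in>?P. axis i 1 - axis j 1)"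
  have c: "c \<bullet> x = a \<bullet> x - (\<Sum>(i, j)\<in>?P. x $ i - x $ j)" for x
    by (simp add: c_def inner_diff_left inner_sum_left inner_axis' case_prod_beta)
  define b where "b = a \<bullet> threshold_degrees a {}"
  have pen: "(\<Sum>(i, j)\<in>?P. x $ i - x $ j) \<ge> 0" if "antimono (\<lambda>i. x $ i)" for x :: "real^'n::{finite,linorder}"
    using that by (intro sum_nonneg) (auto simp: monotone_on_def)
  have pen0: "x $ i = x $ j"
    if x: "antimono (\<lambda>i. x $ i)" "(\<Sum>(i, j)\<in>?P. x $ i - x $ j) = 0" and "a $ i = a $ j"
    for x :: "real^'n::{finite,linorder}" and i j
  proof -
    have "\<forall>p\<in>?P. (case p of (i, j) \<Rightarrow> x $ i - x $ j) = 0"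
      using x by (subst sum_nonneg_eq_0_iff[symmetric]) (auto simp: monotone_on_def)
    then show ?thesis
      using \<open>a $ i = a $ j\<close> by (cases i j rule: linorder_cases) force+
  qed
  have le: "c \<bullet> x \<le> b" if "x \<in> DP" for x
    using pen[OF DP_antimono[OF that]] threshold_degrees_optimal(1)[OF DP_fractional[OF that], of a "{}"]
    by (simp add: c b_def)
  have "convex (DP :: (real^'n::{finite,linorder}) set)" by (simp add: DP_def)
  then have face: "(DP \<inter> {x. c \<bullet> x = b}) face_of DP"
    using le by (rule face_of_Int_supporting_hyperplane_le)
  have thr_F: "threshold_degrees a L \<in> DP \<inter> {x. c \<bullet> x = b}" for L
  proof -
    have "(\<Sum>(i, j)\<in>?P. threshold_degrees a L $ i - threshold_degrees a L $ j) = 0"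
      using threshold_degrees_cong by (intro sum.neutral) auto
    then show ?thesis
      using threshold_degrees_in_DP[OF a] by (simp add: c b_def threshold_degrees_inner_eq[of a L "{}"])
  qed
  have "DP \<inter> {x. c \<bullet> x = b} = closed_segment (threshold_degrees a {}) (threshold_degrees a UNIV)"
  proof
    show "closed_segment (threshold_degrees a {}) (threshold_degrees a UNIV) \<subseteq> DP \<inter> {x. c \<bullet> x = b}"
      using thr_F face_of_imp_convex[OF face] by (intro closed_segment_subset) auto
    show "DP \<inter> {x. c \<bullet> x = b} \<subseteq> closed_segment (threshold_degrees a {}) (threshold_degrees a UNIV)"
    proof
      fix x assume "x \<in> DP \<inter> {x. c \<bullet> x = b}"
      then have x: "x \<in> DP" "c \<bullet> x = b" by auto
      have opt: "a \<bullet> x = a \<bullet> threshold_degrees a {}" and p0: "(\<Sum>(i, j)\<in>?P. x $ i - x $ j) = 0"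
        using pen[OF DP_antimono[OF x(1)]] threshold_degrees_optimal(1)[OF DP_fractional[OF x(1)], of a "{}"] x(2)
        by (simp_all add: c b_def)
      have between: "threshold_degrees a {} \<le> x" "x \<le> threshold_degrees a UNIV"
        using threshold_degrees_optimal(2)[OF DP_fractional[OF x(1)] opt] by auto
      define d where "d = x - threshold_degrees a {}"
      define g where "g = threshold_degrees a UNIV - threshold_degrees a {}"
      \<comment> \<open>Away from the level \<open>v\<close> both ends coincide, and
        \<open>x\<close> lies between them.\<close>
      have d0: "d $ i = 0" and g0: "g $ i = 0" if "\<bar>a $ i\<bar> \<noteq> v" for i
      proof -
        have "threshold_degrees a {} $ i = threshold_degrees a UNIV $ i"
          using that res by (intro threshold_degrees_not_resonant) auto
        then show "d $ i = 0" "g $ i = 0"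
          using between by (auto simp: d_def g_def less_eq_vec_def) (metis order_antisym)
      qed
      have dc: "d $ i = d $ j" and gc: "g $ i = g $ j" if "a $ i = a $ j" for i j
        using threshold_degrees_cong[OF that, of UNIV] threshold_degrees_cong[OF that, of "{}"] pen0[OF DP_antimono[OF x(1)] p0 that]
        by (simp_all add: d_def g_def)
      have "a \<bullet> d = 0" "a \<bullet> g = 0"
        using opt threshold_degrees_inner_eq by (auto simp: d_def g_def inner_diff_right)
      have "v \<in> resonance a" using res by simp
      then obtain k where k: "\<bar>a $ k\<bar> = v" unfolding resonance_def by blast
      have gk: "g $ k > 0" using threshold_degrees_resonant[of a k] k res by (simp add: g_def)
      \<comment> \<open>The multiple of \<open>g\<close> that agrees with \<open>d\<close> at
        \<open>k\<close>, hence wherever \<open>a\<close> takes the value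
        \<open>a $ k\<close>.\<close>
      define t where "t = d $ k / g $ k"
      define z where "z = d - t *\<^sub>R g"
      have zk: "z $ k = 0" using gk by (simp add: z_def t_def)
      have az: "a \<bullet> z = 0" using \<open>a \<bullet> d = 0\<close> \<open>a \<bullet> g = 0\<close> by (simp add: z_def inner_diff_right)
      have z0: "z $ i = 0" if "\<bar>a $ i\<bar> \<noteq> v" for i using d0 g0 that by (simp add: z_def)
      have zc: "z $ i = z $ j" if "a $ i = a $ j" for i j
        using dc[OF that] gc[OF that] by (simp add: z_def)
      \<comment> \<open>\<open>z\<close> can only be nonzero where \<open>a = - a $ k\<close>, and is constant there, so \<open>a \<bullet> z = 0\<close> kills it\<close>
      have "z $ l = 0" for l
      proof (rule ccontr)
        assume l: "z $ l \<noteq> 0"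
        then have "a $ l \<noteq> a $ k" using zk zc by metis
        have "\<bar>a $ l\<bar> = v" using l z0 by blast
        have summand: "a $ i * z $ i = (if a $ i = a $ l then a $ l * z $ l else 0)" for i
        proof (cases "a $ i = a $ l")
          case True then show ?thesis using zc by metis
        next
          case False
          then have "a $ i = a $ k \<or> \<bar>a $ i\<bar> \<noteq> v"
            using \<open>a $ l \<noteq> a $ k\<close> \<open>\<bar>a $ l\<bar> = v\<close> k by linarith
          then have "z $ i = 0" using zk zc z0 by metis
          then show ?thesis using False by simp
        qed
        have "a \<bullet> z = (\<Sum>i\<in>UNIV. a $ i * z $ i)"
          by (simp add: inner_vec_def)
        also have "\<dots> = (\<Sum>i\<in>UNIV. if a $ i = a $ l then a $ l * z $ l else 0)"
          by (intro sum.cong refl summand)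
        finally have "a \<bullet> z = real (card {i. a $ i = a $ l}) * (a $ l * z $ l)"
          by (simp add: sum.If_cases)
        moreover have "card {i. a $ i = a $ l} \<noteq> 0" unfolding card_eq_0_iff by auto
        moreover have "a $ l \<noteq> 0" using \<open>a $ l \<noteq> a $ k\<close> \<open>\<bar>a $ l\<bar> = v\<close> k by linarith
        ultimately show False using az l by simp
      qed
      then have "d = t *\<^sub>R g" by (simp add: z_def vec_eq_iff)
      then show "x \<in> closed_segment (threshold_degrees a {}) (threshold_degrees a UNIV)"
        using closed_segment_resonance[OF res _ between, of t] by (simp add: d_def g_def)
    qed
  qed
  then have "closed_segment (threshold_degrees a {}) (threshold_degrees a UNIV) face_of DP" using face by simp
  moreover have "threshold_degrees a {} \<noteq> threshold_degrees a UNIV"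
  proof -
    have "v \<in> resonance a" using res by simp
    then obtain k where "\<bar>a $ k\<bar> \<in> resonance a" unfolding resonance_def by blast
    from threshold_degrees_resonant[OF this] show ?thesis by force
  qed
  then have "aff_dim (closed_segment (threshold_degrees a {}) (threshold_degrees a UNIV)) = 1"
    by (simp add: segment_convex_hull aff_dim_convex_hull)
  ultimately show ?thesis by (simp add: edge_of_def)
qed

section \<open>Threshold sequences as lists\<close>

text \<open>The \<open>of_bool\<close> term discounts the pairing of an entry with itself.\<close>

definition lower_degrees :: "real list \<Rightarrow> real list" where
  "lower_degrees xs = map (\<lambda>x. real (length (filter (\<lambda>y. x + y > 0) xs)) - of_bool (x > 0)) xs"

definition upper_degrees :: "real list \<Rightarrow> real list" where
  "upper_degrees xs = map (\<lambda>x. real (length (filter (\<lambda>y. x + y \<ge> 0) xs)) - of_bool (x \<ge> 0)) xs"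

text \<open>List form of \<open>resonance\<close>: an entry is compared only with later ones, so it
  is never paired with itself.\<close>

fun resonances :: "real list \<Rightarrow> real set" where
  "resonances [] = {}"
| "resonances (x # xs) = (if - x \<in> set xs then {\<bar>x\<bar>} else {}) \<union> resonances xs"

definition dominate :: "real list \<Rightarrow> real list" where
  "dominate xs = real (length xs) # map (\<lambda>x. x + 1) xs"

definition isolate :: "real list \<Rightarrow> real list" where
  "isolate xs = xs @ [0]"

text \<open>The degree partitions of threshold graphs. From the empty list both operations give
  \<open>[0]\<close>, so their number doubles only from length 1 on.\<close>

fun threshold_seqs :: "nat \<Rightarrow> real list set" where
  "threshold_seqs 0 = {[]}"
| "threshold_seqs (Suc n) = dominate ` threshold_seqs n \<union> isolate ` threshold_seqs n"

text \<open>Empty and complete graph, the two ends when all weights are 0.\<close>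

definition clique_pair :: "nat \<Rightarrow> real list \<times> real list" where
  "clique_pair n = (replicate n 0, replicate n (real n - 1))"

text \<open>The ends for weights \<open>v > 0\<close> on the first \<open>p\<close> vertices,
  \<open>- v\<close> on the last \<open>q\<close>, and weights of smaller absolute value with
  degrees \<open>u\<close> between them. The free pairs join the two outer blocks: accepting them
  adds \<open>q\<close> to each degree in front and \<open>p\<close> to each at the back.\<close>

definition block_pair :: "nat \<Rightarrow> nat \<Rightarrow> real list \<Rightarrow> real list \<times> real list" where
  "block_pair p q u =
    (replicate p (real (p + length u) - 1) @ map (\<lambda>x. x + real p) u @ replicate q 0,
     replicate p (real (p + length u + q) - 1) @ map (\<lambda>x. x + real p) u @ replicate q (real p))"

text \<open>The case of first and last weights that cancel. A free pair needs two vertices, whence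
  the bound for the clique.\<close>

definition outer_pairs :: "nat \<Rightarrow> (real list \<times> real list) set" where
  "outer_pairs n = (if n \<ge> 2 then {clique_pair n} else {}) \<union>
    {block_pair p q u | p q u. 1 \<le> p \<and> 1 \<le> q \<and> p + q \<le> n \<and> u \<in> threshold_seqs (n - p - q)}"

text \<open>The three families correspond to a positive, negative or zero sum of the first and the
  last weight.\<close>

fun edge_pairs :: "nat \<Rightarrow> (real list \<times> real list) set" where
  "edge_pairs 0 = {}"
| "edge_pairs (Suc n) = map_prod dominate dominate ` edge_pairs n \<union>
     map_prod isolate isolate ` edge_pairs n \<union> outer_pairs (Suc n)"

lemma resonances_append:
  "resonances (xs @ ys) = resonances xs \<union> resonances ys \<union> {\<bar>x\<bar> | x. x \<in> set xs \<and> - x \<in> set ys}"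
  by (induction xs) auto

lemma resonances_subset: "resonances xs \<subseteq> abs ` set xs"
  by (induction xs) auto

lemma lower_degrees_dominate: "(\<And>y. y \<in> set ys \<Longrightarrow> x + y > 0) \<Longrightarrow> lower_degrees (x # ys) = dominate (lower_degrees ys)"
  by (auto simp: lower_degrees_def dominate_def add.commute)

lemma upper_degrees_dominate: "(\<And>y. y \<in> set ys \<Longrightarrow> x + y > 0) \<Longrightarrow> upper_degrees (x # ys) = dominate (upper_degrees ys)"
  by (auto simp: upper_degrees_def dominate_def add.commute less_imp_le)

lemma resonances_dominate:
  "(\<And>y. y \<in> set ys \<Longrightarrow> x + y > 0) \<Longrightarrow> resonances (x # ys) = resonances ys"
  by force

lemma lower_degrees_isolate: "(\<And>y. y \<in> set ys \<Longrightarrow> x + y < 0) \<Longrightarrow> lower_degrees (ys @ [x]) = isolate (lower_degrees ys)"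
  by (force simp: lower_degrees_def isolate_def add.commute filter_empty_conv not_less)

lemma upper_degrees_isolate: "(\<And>y. y \<in> set ys \<Longrightarrow> x + y < 0) \<Longrightarrow> upper_degrees (ys @ [x]) = isolate (upper_degrees ys)"
  by (force simp: upper_degrees_def isolate_def add.commute filter_empty_conv not_le)

lemma resonances_isolate:
  "(\<And>y. y \<in> set ys \<Longrightarrow> x + y < 0) \<Longrightarrow> resonances (ys @ [x]) = resonances ys"
  by (force simp: resonances_append)

lemma length_lower_degrees [simp]: "length (lower_degrees xs) = length xs"
  by (simp add: lower_degrees_def)

lemma length_upper_degrees [simp]: "length (upper_degrees xs) = length xs"
  by (simp add: upper_degrees_def)

lemma lower_degrees_clique: "(lower_degrees (replicate n 0), upper_degrees (replicate n 0)) = clique_pair n"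
  by (simp add: lower_degrees_def upper_degrees_def clique_pair_def)

text \<open>The entries \<open>v\<close> have a positive sum with everything except
  \<open>- v\<close>, the entries \<open>- v\<close> a negative one with everything except
  \<open>v\<close>. The middle is thus adjacent to all of the former and none of the latter, and by
  \<open>eq\<close> it looks the same at both ends.\<close>

lemma block_pair_eq:
  fixes v :: real and p q :: nat
  assumes v: "v > 0" and ms: "\<And>m. m \<in> set ms \<Longrightarrow> \<bar>m\<bar> < v" and eq: "upper_degrees ms = lower_degrees ms"
  defines xs: "xs \<equiv> replicate p v @ ms @ replicate q (- v)"
  shows "(lower_degrees xs, upper_degrees xs) = block_pair p q (lower_degrees ms)"
proof -
  have ms': "m + v > 0" "v + m > 0" "\<not> v < m" "\<not> v \<le> m" if "m \<in> set ms" for m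
    using ms[OF that] by linarith+
  have [simp]: "filter (\<lambda>y. v + y > 0) ms = ms" "filter (\<lambda>y. v + y \<ge> 0) ms = ms"
    "filter (\<lambda>y. 0 < y - v) ms = []" "filter (\<lambda>y. v \<le> y) ms = []" "filter (\<lambda>y. v < y) ms = []"
    using ms' by (force simp: filter_empty_conv intro: filter_True)+
  have "lower_degrees xs = fst (block_pair p q (lower_degrees ms))"
    using v by (auto simp: lower_degrees_def xs block_pair_def filter_replicate ms')
  moreover have "upper_degrees xs = snd (block_pair p q (upper_degrees ms))"
    using v by (auto simp: upper_degrees_def xs block_pair_def less_imp_le filter_replicate ms')
  ultimately show ?thesis
    by (simp add: eq block_pair_def)
qed

text \<open>The sum of first and last entry decides: if it is positive, the first entry dominates
  because the last is the smallest; if negative, the last one is isolated. A singleton counts as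
  dominating.\<close>

lemma sorted_ends_cases:
  fixes xs :: "real list"
  assumes "sorted_wrt (\<ge>) xs" "xs \<noteq> []"
  obtains (dominate) x ys where "xs = x # ys" "\<And>y. y \<in> set ys \<Longrightarrow> x + y > 0"
  | (isolate) y ys where "xs = ys @ [y]" "\<And>x. x \<in> set ys \<Longrightarrow> y + x < 0"
  | (resonant) "length xs \<ge> 2" "hd xs + last xs = 0" 
proof (cases xs rule: rev_cases)
  case (snoc ys y)
  show ?thesis
  proof (cases ys)
    case Nil
    then show ?thesis using snoc dominate[of y "[]"] by simp
  next
    case (Cons x zs)
    show ?thesis
    proof (cases "x + y" "0 :: real" rule: linorder_cases)
      case less
      then show ?thesis using isolate[of ys y] snoc Cons assms(1) by (force simp: sorted_wrt_append)
    next
      case equal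
      then show ?thesis using resonant snoc Cons by simp
    next
      case greater
      then show ?thesis
        using dominate[of x "zs @ [y]"] snoc Cons assms(1) by (force simp: sorted_wrt_append)
    qed
  qed
qed (use assms in simp)

text \<open>Without free pairs the end weights cannot cancel, so a dominating or isolated vertex can
  always be removed.\<close>

lemma lower_degrees_no_resonance:
  assumes "sorted_wrt (\<ge>) xs" "resonances xs = {}"
  shows "upper_degrees xs = lower_degrees xs \<and> lower_degrees xs \<in> threshold_seqs (length xs)"
  using assms
proof (induction xs rule: length_induct)
  case (1 xs)
  show ?case
  proof (cases "xs = []")
    case True
    then show ?thesis by (simp add: lower_degrees_def upper_degrees_def)
  next
    case False
    from 1(2) False show ?thesis
    proof (cases rule: sorted_ends_cases)
      case (dominate x ys)
      then show ?thesis
        using 1 by (auto simp: lower_degrees_dominate upper_degrees_dominate resonances_dominate simp del: resonances.simps)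
    next
      case (isolate y ys)
      then show ?thesis
        using 1 by (auto simp: lower_degrees_isolate upper_degrees_isolate resonances_isolate sorted_wrt_append)
    next
      case resonant
      then obtain x ys y where "xs = x # ys @ [y]"
        by (cases xs; cases "tl xs" rule: rev_cases) auto
      then have "- x \<in> set (ys @ [y])" using resonant by (auto simp: add_eq_0_iff)
      then have False using 1(3) \<open>xs = x # ys @ [y]\<close> by simp
      then show ?thesis ..
    qed
  qed
qed

text \<open>Sorting puts the extreme values \<open>v\<close> and \<open>- v\<close> at the ends,
  where they are peeled off one at a time.\<close>

lemma sorted_split:
  fixes v :: real
  assumes "sorted_wrt (\<ge>) xs" "\<forall>x\<in>set xs. \<bar>x\<bar> \<le> v"
  shows "\<exists>p q ms. xs = replicate p v @ ms @ replicate q (- v) \<and> (\<forall>m\<in>set ms. \<bar>m\<bar> < v)"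
  using assms
proof (induction xs rule: length_induct)
  case (1 xs)
  show ?case
  proof (cases "\<forall>x\<in>set xs. \<bar>x\<bar> < v")
    case True
    then show ?thesis by (intro exI[of _ 0] exI[of _ xs]) simp
  next
    case False
    then obtain x where x: "x \<in> set xs" "x = v \<or> x = - v"
      using 1(3) by (smt (verit))
    show ?thesis
    proof (cases "x = v")
      case True
      obtain y ys where ys: "xs = y # ys" using x(1) by (cases xs) auto
      have "y = v" using ys x(1) True 1(2,3) by force
      obtain p q ms where "ys = replicate p v @ ms @ replicate q (- v)" "\<forall>m\<in>set ms. \<bar>m\<bar> < v"
        using 1(1)[rule_format, of ys] 1(2,3) ys by auto
      then show ?thesis
        using ys \<open>y = v\<close> by (intro exI[of _ "Suc p"] exI[of _ q] exI[of _ ms]) simp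
    next
      case False
      then have xv: "x = - v" using x(2) by simp
      obtain y ys where ys: "xs = ys @ [y]" using x(1) by (cases xs rule: rev_cases) auto
      have "y = - v" using ys x(1) xv 1(2,3) by (force simp: sorted_wrt_append)
      obtain p q ms where "ys = replicate p v @ ms @ replicate q (- v)" "\<forall>m\<in>set ms. \<bar>m\<bar> < v"
        using 1(1)[rule_format, of ys] 1(2,3) ys by (auto simp: sorted_wrt_append)
      then show ?thesis
        using ys \<open>y = - v\<close> by (intro exI[of _ p] exI[of _ "Suc q"] exI[of _ ms])
          (simp add: replicate_append_same)
    qed
  qed
qed

text \<open>Dominating and isolated end vertices are removed until the ends cancel and so lie on the
  only free level. Then either all weights vanish, or the middle between the outer blocks has no
  free pairs.\<close>

lemma lower_upper_degrees_single_resonance: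
  assumes "sorted_wrt (\<ge>) xs" "resonances xs = {v}"
  shows "(lower_degrees xs, upper_degrees xs) \<in> edge_pairs (length xs)"
  using assms
proof (induction xs rule: length_induct)
  case (1 xs)
  have "xs \<noteq> []" using 1(3) by auto
  from 1(2) this show ?case
  proof (cases rule: sorted_ends_cases)
    case (dominate x ys)
    then have "(lower_degrees ys, upper_degrees ys) \<in> edge_pairs (length ys)"
      using 1 by (auto simp: resonances_dominate simp del: resonances.simps)
    then show ?thesis
      using dominate by (force simp: lower_degrees_dominate upper_degrees_dominate)
  next
    case (isolate y ys)
    then have "(lower_degrees ys, upper_degrees ys) \<in> edge_pairs (length ys)"
      using 1 by (auto simp: resonances_isolate sorted_wrt_append)
    then show ?thesis
      using isolate by (force simp: lower_degrees_isolate upper_degrees_isolate)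
  next
    case resonant
    let ?v = "hd xs"
    obtain x ys y where xs: "xs = x # ys @ [y]"
      using resonant by (cases xs; cases "tl xs" rule: rev_cases) auto
    have y: "y = - x" using resonant xs by simp
    have x0: "x \<ge> 0" using 1(2) xs y by simp
    have bound: "\<bar>z\<bar> \<le> x" if "z \<in> set xs" for z
      using that 1(2) xs y x0 by (fastforce simp: sorted_wrt_append)
    have "(lower_degrees xs, upper_degrees xs) \<in> outer_pairs (length xs)"
    proof (cases "x = 0")
      case True
      then have "xs = replicate (length xs) 0"
        using bound by (intro replicate_eqI) auto
      then show ?thesis
        using lower_degrees_clique[of "length xs"] resonant by (auto simp: outer_pairs_def)
    next
      case False
      then have "x > 0" using x0 by simp
      obtain p q ms where split: "xs = replicate p x @ ms @ replicate q (- x)"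
        and ms': "\<forall>m\<in>set ms. \<bar>m\<bar> < x"
        using sorted_split[OF 1(2), of x] bound by metis
      have ms: "\<bar>m\<bar> < x" if "m \<in> set ms" for m using ms' that by blast
      have "p \<noteq> 0"
      proof
        assume "p = 0"
        then have "xs = ms @ replicate q (- x)" using split by simp
        then have "x \<in> set ms \<or> x = - x" using xs by (cases ms; cases q) auto
        then show False using ms[of x] \<open>x > 0\<close> by auto
      qed
      moreover have "q \<noteq> 0"
      proof
        assume "q = 0"
        then have "xs = replicate p x @ ms" using split by simp
        then have "- x \<in> set (replicate p x @ ms)" using xs y by (metis list.set_intros(2) Un_iff set_append in_set_conv_decomp)
        then show False using ms[of "- x"] \<open>x > 0\<close> by (auto split: if_splits)
      qed
      moreover have "resonances ms \<subseteq> {v}"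
        using 1(3) split by (auto simp: resonances_append)
      moreover have "x \<in> resonances xs"
        using xs y x0 by simp
      then have "v = x" using 1(3) by simp
      \<comment> \<open>The entries of \<open>ms\<close> are smaller than \<open>x\<close> in
        absolute value, so the only admissible level \<open>v = x\<close> does not occur among
        them.\<close>
      moreover have "x \<notin> resonances ms"
        using resonances_subset ms by fastforce
      ultimately have "resonances ms = {}" by auto
      moreover have "sorted_wrt (\<ge>) ms"
        using 1(2) split by (simp add: sorted_wrt_append)
      ultimately have "upper_degrees ms = lower_degrees ms" "lower_degrees ms \<in> threshold_seqs (length ms)"
        using lower_degrees_no_resonance by auto
      then have "(lower_degrees xs, upper_degrees xs) = block_pair p q (lower_degrees ms)" 
        using block_pair_eq[OF \<open>x > 0\<close> ms] split by simp
      moreover have "length xs - p - q = length ms" "p + q \<le> length xs" using split by simp_all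
      ultimately show ?thesis
        using \<open>p \<noteq> 0\<close> \<open>q \<noteq> 0\<close> \<open>lower_degrees ms \<in> _\<close> unfolding outer_pairs_def
        by (intro UnI2 CollectI exI[of _ p] exI[of _ q] exI[of _ "lower_degrees ms"]) simp
    qed
    then show ?thesis using \<open>xs \<noteq> []\<close> by (cases xs) auto
  qed
qed

section \<open>Weights realising the recursively built pairs\<close>

text \<open>A new outermost vertex gets the weight \<open>M\<close> or \<open>- M\<close>, whose
  sign then decides every sum with an old weight.\<close>

lemma bounding_weight:
  obtains M :: real where "M > 0" "\<And>x. x \<in> set xs \<Longrightarrow> \<bar>x\<bar> < M"
proof
  let ?A = "insert 0 (abs ` set xs)"
  have le: "x \<le> Max ?A" if "x \<in> ?A" for x
    using that by (intro Max_ge) auto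
  show "Max ?A + 1 > 0"
    using le[OF insertI1] by linarith
  show "\<bar>x\<bar> < Max ?A + 1" if "x \<in> set xs" for x
    using le[OF insertI2[OF imageI[OF that]]] by linarith
qed

text \<open>\<open>R\<close> is empty for a threshold sequence and a singleton for an edge.\<close>

definition realizes :: "real list \<Rightarrow> real list \<Rightarrow> real list \<Rightarrow> real set \<Rightarrow> bool" where
  "realizes xs l u R \<longleftrightarrow> sorted_wrt (\<ge>) xs \<and> resonances xs = R \<and> lower_degrees xs = l \<and> upper_degrees xs = u"

lemma realizes_dominate:
  assumes "realizes xs l u R" obtains x where "realizes (x # xs) (dominate l) (dominate u) R"
proof -
  obtain M where M: "M > 0" "\<And>x. x \<in> set xs \<Longrightarrow> \<bar>x\<bar> < M" using bounding_weight by blast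
  then have "M + x > 0" "x \<le> M" if "x \<in> set xs" for x using M(2)[OF that] by linarith+
  then have "realizes (M # xs) (dominate l) (dominate u) R"
    using assms unfolding realizes_def
    by (simp add: lower_degrees_dominate upper_degrees_dominate resonances_dominate del: resonances.simps)
  then show thesis by (rule that)
qed

lemma realizes_isolate:
  assumes "realizes xs l u R" obtains x where "realizes (xs @ [x]) (isolate l) (isolate u) R"
proof -
  obtain M where M: "M > 0" "\<And>x. x \<in> set xs \<Longrightarrow> \<bar>x\<bar> < M" using bounding_weight by blast
  then have "- M + x < 0" "- M \<le> x" if "x \<in> set xs" for x using M(2)[OF that] by linarith+
  then have "realizes (xs @ [- M]) (isolate l) (isolate u) R"
    using assms unfolding realizes_def
    by (simp add: lower_degrees_isolate upper_degrees_isolate resonances_isolate sorted_wrt_append)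
  then show thesis by (rule that)
qed

lemma realizes_length: "realizes xs l u R \<Longrightarrow> length xs = length l"
  by (auto simp: realizes_def)

lemma threshold_seqs_realizable:
  "u \<in> threshold_seqs n \<Longrightarrow> \<exists>xs. realizes xs u u {}"
proof (induction n arbitrary: u)
  case 0
  then show ?case by (intro exI[of _ "[]"]) (simp add: realizes_def lower_degrees_def upper_degrees_def)
next
  case (Suc n)
  then consider w where "w \<in> threshold_seqs n" "u = dominate w" | w where "w \<in> threshold_seqs n" "u = isolate w"
    by auto
  then show ?case
    using Suc.IH by cases (metis realizes_dominate, metis realizes_isolate)
qed

lemma resonances_replicate: "v \<noteq> 0 \<Longrightarrow> resonances (replicate p v) = {}"
  by (induction p) auto

text \<open>All weights are 0 for the clique pair. For a block pair the weights of the middle are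
  surrounded by copies of \<open>M\<close> and \<open>- M\<close>, too large to cancel with any of
  them.\<close>

lemma outer_pairs_realizable:
  assumes "(l, u) \<in> outer_pairs n" shows "\<exists>xs v. realizes xs l u {v}"
proof -
  consider "n \<ge> 2" "(l, u) = clique_pair n"
    | p q w where "1 \<le> p" "1 \<le> q" "p + q \<le> n" "w \<in> threshold_seqs (n - p - q)" "(l, u) = block_pair p q w"
    using assms by (auto simp: outer_pairs_def split: if_splits)
  then show ?thesis
  proof cases
    case 1
    obtain k where "n = Suc (Suc k)"
      using 1(1) by (metis One_nat_def Suc_1 Suc_le_D Suc_le_mono)
    then have "resonances (replicate n 0) = {0}"
      using resonances_subset[of "replicate k 0"] by auto
    moreover have "sorted_wrt (\<ge>) (replicate n (0 :: real))"
      by (simp add: sorted_wrt_iff_nth_less)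
    moreover have "(lower_degrees (replicate n 0), upper_degrees (replicate n 0)) = (l, u)"
      using lower_degrees_clique 1(2) by simp
    ultimately show ?thesis
      by (intro exI[of _ "replicate n 0"] exI[of _ 0]) (simp add: realizes_def)
  next
    case (2 p q w)
    then obtain ms where ms: "sorted_wrt (\<ge>) ms" "resonances ms = {}" "lower_degrees ms = w" "upper_degrees ms = w"
      using threshold_seqs_realizable[OF 2(4)] unfolding realizes_def by blast
    obtain M where M: "M > 0" "\<And>x. x \<in> set ms \<Longrightarrow> \<bar>x\<bar> < M" using bounding_weight by blast
    let ?xs = "replicate p M @ ms @ replicate q (- M)"
    have "(lower_degrees ?xs, upper_degrees ?xs) = (l, u)"
      using block_pair_eq[OF M, where p = p and q = q] ms 2(5) by simp
    moreover have "- M \<notin> set ms" "- x \<in> set ms \<Longrightarrow> x \<noteq> M" for x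
      using M(2)[of "- M"] M(1) by auto
    then have "resonances ?xs = {M}"
      using 2(1,2) ms(2) M by (auto simp: resonances_append resonances_replicate)
    moreover have "sorted_wrt (\<ge>) (replicate k (c :: real))" for k c
      by (simp add: sorted_wrt_iff_nth_less)
    then have "sorted_wrt (\<ge>) ?xs"
      using ms(1) M abs_less_iff by (fastforce simp: sorted_wrt_append)
    ultimately show ?thesis
      by (intro exI[of _ ?xs] exI[of _ M]) (simp add: realizes_def)
  qed
qed

lemma edge_pairs_realizable:
  "(l, u) \<in> edge_pairs n \<Longrightarrow> \<exists>xs v. realizes xs l u {v}"
proof (induction n arbitrary: l u)
  case (Suc n)
  then consider l' u' where "(l', u') \<in> edge_pairs n" "l = dominate l'" "u = dominate u'"
    | l' u' where "(l', u') \<in> edge_pairs n" "l = isolate l'" "u = isolate u'"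
    | "(l, u) \<in> outer_pairs (Suc n)"
    by auto
  then show ?case
  proof cases
    case 1 then show ?thesis using Suc.IH by (metis realizes_dominate)
  next
    case 2 then show ?thesis using Suc.IH by (metis realizes_isolate)
  next
    case 3 then show ?thesis by (rule outer_pairs_realizable)
  qed
qed simp

section \<open>Counting\<close>

lemma threshold_seqs_nonneg: "u \<in> threshold_seqs n \<Longrightarrow> x \<in> set u \<Longrightarrow> 0 \<le> x"
proof (induction n arbitrary: u x)
  case (Suc n)
  then show ?case by (auto simp: dominate_def isolate_def intro: add_nonneg_nonneg)
qed simp

lemma threshold_seqs_length: "u \<in> threshold_seqs n \<Longrightarrow> length u = n"
  by (induction n arbitrary: u) (auto simp: dominate_def isolate_def)

lemma inj_dominate: "inj dominate"
proof (rule injI)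
  fix u w assume "dominate u = dominate w"
  then have "map (\<lambda>x. x + 1) u = map (\<lambda>x. x + 1) w" by (simp add: dominate_def)
  then show "u = w" by (rule map_injective) (simp add: inj_def)
qed

lemma inj_isolate: "inj isolate"
  by (auto simp: inj_def isolate_def)

text \<open>The last entry tells \<open>dominate\<close> from \<open>isolate\<close>. The empty list
  is excluded because both operations turn it into \<open>[0]\<close>.\<close>

lemma last_dominate_pos:
  assumes "\<And>x. x \<in> set u \<Longrightarrow> 0 \<le> x" "u \<noteq> []" shows "last (dominate u) > 0"
proof -
  have "last (dominate u) = last u + 1"
    using assms(2) by (simp add: dominate_def last_map)
  then show ?thesis using assms(1)[OF last_in_set[OF assms(2)]] by simp
qed

lemma last_isolate: "last (isolate u) = 0"
  by (simp add: isolate_def)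

lemma finite_threshold_seqs: "finite (threshold_seqs n)"
  by (induction n) auto

lemma card_threshold_seqs: "card (threshold_seqs (Suc n)) = 2 ^ n"
proof (induction n)
  case 0
  then show ?case by (simp add: dominate_def isolate_def)
next
  case (Suc n)
  have "dominate ` threshold_seqs (Suc n) \<inter> isolate ` threshold_seqs (Suc n) = {}"
  proof -
    have "dominate u \<noteq> isolate w" if "u \<in> threshold_seqs (Suc n)" for u w
    proof -
      have "u \<noteq> []" using threshold_seqs_length[OF that] by auto
      then have "last (dominate u) > 0"
        using last_dominate_pos threshold_seqs_nonneg[OF that] by blast
      then show ?thesis using last_isolate[of w] by force
    qed
    then show ?thesis by blast
  qed
  then have "card (threshold_seqs (Suc (Suc n))) =
      card (dominate ` threshold_seqs (Suc n)) + card (isolate ` threshold_seqs (Suc n))"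
    by (subst threshold_seqs.simps) (intro card_Un_disjoint finite_imageI finite_threshold_seqs)
  also have "\<dots> = 2 ^ n + 2 ^ n"
    using Suc inj_dominate inj_isolate by (simp add: card_image inj_on_subset[OF _ subset_UNIV] del: threshold_seqs.simps)
  finally show ?case by simp
qed

text \<open>The empty sequence completes the geometric sum:
  \<open>1 + 1 + 2 + ... + 2 ^ (n - 1) = 2 ^ n\<close>.\<close>

lemma sum_card_threshold_seqs: "(\<Sum>k\<le>n. card (threshold_seqs k)) = 2 ^ n"
proof (induction n)
  case (Suc n)
  then show ?case using card_threshold_seqs[of n] by (simp del: threshold_seqs.simps)
qed simp

section \<open>The number of outer pairs\<close>

definition block_params :: "nat \<Rightarrow> (nat \<times> nat \<times> real list) set" where
  "block_params n = (SIGMA p : {1..<n}. SIGMA q : {1..n - p}. threshold_seqs (n - p - q))"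

lemma outer_pairs_eq:
  "outer_pairs n = (if n \<ge> 2 then {clique_pair n} else {}) \<union> (\<lambda>(p, q, u). block_pair p q u) ` block_params n"
proof -
  have "(p, q, u) \<in> block_params n \<longleftrightarrow>
      1 \<le> p \<and> 1 \<le> q \<and> p + q \<le> n \<and> u \<in> threshold_seqs (n - p - q)" for p q u
    by (auto simp: block_params_def)
  moreover have "(\<lambda>(p, q, u). block_pair p q u) ` block_params n =
      {block_pair p q u | p q u. (p, q, u) \<in> block_params n}"
    by force
  ultimately show ?thesis by (simp add: outer_pairs_def)
qed

lemma finite_block_params: "finite (block_params n)"
  unfolding block_params_def by (intro finite_SigmaI finite_threshold_seqs) auto

text \<open>For fixed \<open>p\<close> the length of the middle takes every value up to
  \<open>n - p\<close>, giving \<open>2 ^ (n - p)\<close> choices; the sum over \<open>p\<close> is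
  geometric.\<close>

lemma card_block_params: "card (block_params (Suc n)) = 2 ^ n - 1"
proof -
  have inner: "card (SIGMA q : {1..Suc n - p}. threshold_seqs (Suc n - p - q)) = 2 ^ (n - p)"
    if "p \<in> {1..<Suc n}" for p
  proof -
    have "card (SIGMA q : {1..Suc n - p}. threshold_seqs (Suc n - p - q)) =
        (\<Sum>q\<in>{1..Suc n - p}. card (threshold_seqs (Suc n - p - q)))"
      by (simp add: finite_threshold_seqs)
    also have "\<dots> = (\<Sum>k\<le>n - p. card (threshold_seqs k))"
      using that by (intro sum.reindex_bij_witness[of _ "\<lambda>k. Suc n - p - k" "\<lambda>q. Suc n - p - q"]) auto
    finally show ?thesis by (simp add: sum_card_threshold_seqs)
  qed
  have "card (block_params (Suc n)) = (\<Sum>p\<in>{1..<Suc n}. 2 ^ (n - p))"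
    unfolding block_params_def using inner
    by (subst card_SigmaI) (auto simp: finite_threshold_seqs intro!: sum.cong finite_SigmaI)
  also have "\<dots> = (\<Sum>k<n. 2 ^ k)"
    by (intro sum.reindex_bij_witness[of _ "\<lambda>k. n - k" "\<lambda>p. n - p"]) auto
  also have "\<dots> = 2 ^ n - 1"
    using sum_power2[of n] by (simp add: lessThan_atLeast0)
  finally show ?thesis .
qed

text \<open>The gain at the first vertex recovers \<open>q\<close>, just as the gain at the last one
  recovers \<open>p\<close>; this yields injectivity in the parameters.\<close>

lemma block_pair_hd:
  "p \<ge> 1 \<Longrightarrow> hd (snd (block_pair p q u)) - hd (fst (block_pair p q u)) = real q"
  by (cases p) (auto simp: block_pair_def)

lemma block_pair_last:
  "q \<ge> 1 \<Longrightarrow> last (fst (block_pair p q u)) = 0 \<and> last (snd (block_pair p q u)) = real p"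
  by (auto simp: block_pair_def)

lemma clique_pair_hd_last:
  assumes "n \<ge> 1"
  shows "hd (snd (clique_pair n)) - hd (fst (clique_pair n)) = real n - 1"
    "last (fst (clique_pair n)) = 0" "last (snd (clique_pair n)) = real n - 1"
  using assms by (auto simp: clique_pair_def hd_replicate)

lemma inj_on_block_pair: "inj_on (\<lambda>(p, q, u). block_pair p q u) (block_params n)"
proof (rule inj_onI)
  fix e e' assume "e \<in> block_params n" "e' \<in> block_params n"
    and "(case e of (p, q, u) \<Rightarrow> block_pair p q u) = (case e' of (p, q, u) \<Rightarrow> block_pair p q u)"
  then obtain p q u p' q' u' where e: "e = (p, q, u)" "e' = (p', q', u')"
    and pq: "p \<ge> 1" "q \<ge> 1" "p' \<ge> 1" "q' \<ge> 1" and eq: "block_pair p q u = block_pair p' q' u'"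
    by (auto simp: block_params_def)
  have "q = q'" using block_pair_hd pq eq by (metis of_nat_eq_iff)
  moreover have "p = p'" using eq block_pair_last pq by (metis of_nat_eq_iff)
  moreover have "u = u'"
  proof -
    have "map (\<lambda>x. x + real p) u = map (\<lambda>x. x + real p) u'"
      using eq calculation by (simp add: block_pair_def)
    then show ?thesis by (rule map_injective) (simp add: inj_def)
  qed
  ultimately show "e = e'" using e by simp
qed

lemma card_outer_pairs:
  assumes "n \<ge> 3" shows "card (outer_pairs n) = 2 ^ (n - 1)"
proof -
  have "clique_pair n \<noteq> block_pair p q u" if "(p, q, u) \<in> block_params n" for p q u
  proof
    have pq: "p \<ge> 1" "q \<ge> 1" "p + q \<le> n" using that by (auto simp: block_params_def)
    assume eq: "clique_pair n = block_pair p q u"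
    then have "real q = real n - 1" "real p = real n - 1"
      using block_pair_hd[OF pq(1), of q u] block_pair_last[OF pq(2), of p u] clique_pair_hd_last[of n] assms
      by simp_all
    \<comment> \<open>For the clique both gains are \<open>n - 1\<close>, and
      \<open>2 * n - 2\<close> exceeds \<open>n\<close> once \<open>n\<close> is at least 3.\<close>
    then have "real (p + q) = 2 * real n - 2" by simp
    then show False using pq assms by linarith
  qed
  then have "clique_pair n \<notin> (\<lambda>(p, q, u). block_pair p q u) ` block_params n" by auto
  then have "card (outer_pairs n) = Suc (card (block_params n))"
    using assms inj_on_block_pair by (simp add: outer_pairs_eq card_image finite_block_params)
  also have "\<dots> = 2 ^ (n - 1)"
    using card_block_params[of "n - 1"] assms by simp
  finally show ?thesis .
qed

text \<open>For two vertices the clique pair is also the only block pair, so there is one pair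
  instead of \<open>2 ^ (2 - 1)\<close>.\<close>

lemma outer_pairs_2: "outer_pairs 2 = {([0, 0], [1, 1])}"
proof -
  have "block_params 2 = {(1, 1, [])}"
    by (auto simp: block_params_def)
  then show ?thesis
    by (simp add: outer_pairs_eq clique_pair_def block_pair_def numeral_2_eq_2)
qed

lemma outer_pairs_last:
  assumes "(l, u) \<in> outer_pairs n" shows "last l = 0 \<and> last u > 0"
proof -
  consider "n \<ge> 2" "(l, u) = clique_pair n" | p q w where "1 \<le> p" "1 \<le> q" "(l, u) = block_pair p q w"
    using assms by (auto simp: outer_pairs_def split: if_splits)
  then show ?thesis
  proof cases
    case 1
    then show ?thesis by (auto simp: clique_pair_def)
  next
    case (2 p q w)
    then show ?thesis by (auto simp: block_pair_def)
  qed
qed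

lemma outer_pairs_1: "outer_pairs (Suc 0) = {}"
  by (auto simp: outer_pairs_def)

lemma outer_pairs_nonneg:
  assumes "(l, u) \<in> outer_pairs n" "x \<in> set l" shows "0 \<le> x"
proof -
  consider "n \<ge> 2" "(l, u) = clique_pair n"
    | p q w where "1 \<le> p" "w \<in> threshold_seqs (n - p - q)" "(l, u) = block_pair p q w"
    using assms(1) by (auto simp: outer_pairs_def split: if_splits)
  then show ?thesis
  proof cases
    case 1
    then show ?thesis using assms(2) by (simp add: clique_pair_def)
  next
    case (2 p q w)
    then show ?thesis
      using assms(2) threshold_seqs_nonneg[OF 2(2)] by (auto simp: block_pair_def)
  qed
qed

section \<open>The recurrence for edge pairs\<close>

lemma edge_pairs_nonneg: "(l, u) \<in> edge_pairs n \<Longrightarrow> x \<in> set l \<Longrightarrow> 0 \<le> x"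
proof (induction n arbitrary: l u x)
  case (Suc n)
  then show ?case
    using outer_pairs_nonneg by (force simp: dominate_def isolate_def)
qed simp

lemma edge_pairs_length:
  "(l, u) \<in> edge_pairs n \<Longrightarrow> length l = n \<and> length u = n"
proof (induction n arbitrary: l u)
  case (Suc n)
  have "length l = n \<and> length u = n" if "(l, u) \<in> outer_pairs n" for n
    using that threshold_seqs_length
    by (fastforce simp: outer_pairs_def clique_pair_def block_pair_def split: if_splits)
  then show ?case
    using Suc by (fastforce simp: dominate_def isolate_def)
qed simp

lemma finite_edge_pairs: "finite (edge_pairs n)"
  by (induction n) (auto simp: outer_pairs_eq finite_block_params)

lemma edge_pairs_2: "edge_pairs 2 = {([0, 0], [1, 1])}"
  using outer_pairs_2 by (simp add: numeral_2_eq_2 outer_pairs_1)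

text \<open>The three families are told apart by last entries: positive in the lower list, zero in
  both lists, or zero in the lower and positive in the upper one.\<close>

lemma card_edge_pairs_Suc:
  assumes "n \<ge> 2"
  shows "card (edge_pairs (Suc n)) = 2 * card (edge_pairs n) + 2 ^ n"
proof -
  let ?D = "map_prod dominate dominate ` edge_pairs n"
  let ?I = "map_prod isolate isolate ` edge_pairs n"
  let ?Q = "outer_pairs (Suc n)"
  have D: "last (fst e) > 0" if e: "e \<in> ?D" for e
  proof -
    obtain l u where lu: "(l, u) \<in> edge_pairs n" "e = (dominate l, dominate u)" using e by auto
    have "l \<noteq> []" using edge_pairs_length[OF lu(1)] assms by auto
    then show ?thesis using last_dominate_pos edge_pairs_nonneg[OF lu(1)] lu(2) by simp
  qed
  have I: "last (fst e) = 0 \<and> last (snd e) = 0" if "e \<in> ?I" for e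
    using that last_isolate by auto
  have Q: "last (fst e) = 0 \<and> last (snd e) > 0" if "e \<in> ?Q" for e
    using that outer_pairs_last by (cases e) auto
  have "?D \<inter> ?I = {}" "(?D \<union> ?I) \<inter> ?Q = {}"
    using D I Q by fastforce+
  then have "card (edge_pairs (Suc n)) = card ?D + card ?I + card ?Q"
    by (simp add: card_Un_disjoint finite_edge_pairs outer_pairs_eq finite_block_params)
  moreover have "card ?D = card (edge_pairs n)" "card ?I = card (edge_pairs n)"
    using inj_dominate inj_isolate
    by (auto intro!: card_image inj_on_subset[OF prod.inj_map subset_UNIV])
  moreover have "card ?Q = 2 ^ n" using card_outer_pairs[of "Suc n"] assms by simp
  ultimately show ?thesis by simp
qed

lemma card_edge_pairs: "card (edge_pairs (n + 2)) = 2 ^ n * (2 * n + 1)"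
proof (induction n)
  case 0
  then show ?case using edge_pairs_2 by (simp add: numeral_2_eq_2 del: edge_pairs.simps)
next
  case (Suc n)
  then show ?case using card_edge_pairs_Suc[of "n + 2"] by (simp del: edge_pairs.simps add: algebra_simps)
qed

section \<open>Transfer between vectors and lists\<close>

definition coords :: "real^'n::{finite,linorder} \<Rightarrow> real list" where
  "coords x = map (\<lambda>i. x $ i) (sorted_list_of_set UNIV)"

lemma inj_coords: "inj coords"
  by (auto simp: inj_def coords_def vec_eq_iff)

lemma length_coords: "length (coords (x :: real^'n::{finite,linorder})) = CARD('n)"
  by (simp add: coords_def)

lemma length_filter_coords:
  "length (filter P (coords x)) = card {i. P (x $ i)}"
proof -
  have "length (filter P (coords x)) = card (set (filter (P \<circ> (\<lambda>i. x $ i)) (sorted_list_of_set UNIV)))"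
    unfolding coords_def filter_map length_map by (intro distinct_card[symmetric] distinct_filter) simp
  then show ?thesis by simp
qed

lemma coords_lower_degrees: "coords (threshold_degrees a {}) = lower_degrees (coords a)"
proof -
  have "threshold_degrees a {} $ i = real (length (filter (\<lambda>y. a $ i + y > 0) (coords a))) - of_bool (a $ i > 0)" for i
  proof -
    \<comment> \<open>The list count includes \<open>i\<close> itself exactly when its weight is
      positive.\<close>
    have "{j. a $ i + a $ j > 0} = {j. threshold_adj a {} i j} \<union> (if a $ i > 0 then {i} else {})"
      by (auto simp: threshold_adj_def)
    moreover have "i \<notin> {j. threshold_adj a {} i j}" by (simp add: threshold_adj_def)
    ultimately show ?thesis by (simp add: length_filter_coords threshold_degrees_def)
  qed
  then show ?thesis by (simp add: lower_degrees_def) (simp add: coords_def)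
qed

lemma coords_upper_degrees: "coords (threshold_degrees a UNIV) = upper_degrees (coords a)"
proof -
  have "threshold_degrees a UNIV $ i = real (length (filter (\<lambda>y. a $ i + y \<ge> 0) (coords a))) - of_bool (a $ i \<ge> 0)" for i
  proof -
    have "{j. a $ i + a $ j \<ge> 0} = {j. threshold_adj a UNIV i j} \<union> (if a $ i \<ge> 0 then {i} else {})"
      by (auto simp: threshold_adj_def)
    moreover have "i \<notin> {j. threshold_adj a UNIV i j}" by (simp add: threshold_adj_def)
    ultimately show ?thesis by (simp add: length_filter_coords threshold_degrees_def)
  qed
  then show ?thesis by (simp add: upper_degrees_def) (simp add: coords_def)
qed

text \<open>Looking only at later partners loses nothing, because cancelling entries have the same
  absolute value.\<close>

lemma resonances_map:
  "distinct is \<Longrightarrow> resonances (map f is) =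
     {\<bar>f i\<bar> | i j. i \<in> set is \<and> j \<in> set is \<and> i \<noteq> j \<and> f i + f j = 0}"
proof (induction "is")
  case (Cons k ks)
  let ?R = "\<lambda>A. {\<bar>f i\<bar> | i j. i \<in> A \<and> j \<in> A \<and> i \<noteq> j \<and> f i + f j = 0}"
  let ?H = "if - f k \<in> f ` set ks then {\<bar>f k\<bar>} else {}"
  have opp: "f j = - f k" if "f k + f j = 0 \<or> f j + f k = 0" for j
    using that by linarith
  have "?R (set (k # ks)) \<subseteq> ?H \<union> ?R (set ks)"
  proof
    fix x assume "x \<in> ?R (set (k # ks))"
    then obtain i j where ij: "x = \<bar>f i\<bar>" "i \<in> set (k # ks)" "j \<in> set (k # ks)" "i \<noteq> j" "f i + f j = 0"
      by blast
    consider "i = k" "j \<in> set ks" | "j = k" "i \<in> set ks" | "i \<in> set ks" "j \<in> set ks"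
      using ij by auto
    then show "x \<in> ?H \<union> ?R (set ks)"
    proof cases
      case 1
      then have "- f k \<in> f ` set ks" using opp[of j] ij by (metis imageI)
      then show ?thesis using 1 ij by simp
    next
      case 2
      then have "- f k \<in> f ` set ks" "x = \<bar>f k\<bar>" using opp[of i] ij by (metis imageI, simp)
      then show ?thesis by simp
    next
      case 3
      then show ?thesis using ij by blast
    qed
  qed
  moreover have "?H \<union> ?R (set ks) \<subseteq> ?R (set (k # ks))"
  proof -
    have "\<bar>f k\<bar> \<in> ?R (set (k # ks))" if "- f k \<in> f ` set ks"
    proof -
      obtain j where "j \<in> set ks" "f k + f j = 0" using \<open>- f k \<in> f ` set ks\<close> by auto
      then show ?thesis using Cons.prems by force
    qed
    then show ?thesis by (auto split: if_splits)
  qed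
  ultimately show ?case
    using Cons by (simp only: list.map resonances.simps set_map distinct.simps)
qed simp

lemma resonances_coords: "resonances (coords a) = resonance a"
  unfolding coords_def resonance_def by (subst resonances_map) auto

lemma sorted_coords:
  fixes a :: "real^'n::{finite,linorder}"
  shows "sorted_wrt (\<ge>) (coords a) \<longleftrightarrow> antimono (\<lambda>i. a $ i)"
proof
  assume "antimono (\<lambda>i. a $ i)"
  then show "sorted_wrt (\<ge>) (coords a)"
    unfolding coords_def sorted_wrt_map
    by (intro sorted_wrt_mono_rel[OF _ sorted_sorted_list_of_set]) (auto simp: monotone_on_def)
next
  let ?is = "sorted_list_of_set (UNIV :: 'n set)"
  assume s: "sorted_wrt (\<ge>) (coords a)"
  show "antimono (\<lambda>i. a $ i)"
  proof (rule monotoneI)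
    fix i j :: 'n assume "i \<le> j"
    obtain k l where kl: "k < length ?is" "?is ! k = i" "l < length ?is" "?is ! l = j"
      by (metis UNIV_I finite in_set_conv_nth set_sorted_list_of_set)
    show "a $ j \<le> a $ i"
    proof (cases "k \<le> l")
      case True
      then show ?thesis
        using s kl sorted_wrt_nth_less[of "(\<ge>)" "coords a" k l] by (cases "k = l") (auto simp: coords_def)
    next
      case False
      then have "?is ! l \<le> ?is ! k" using kl by (intro sorted_nth_mono) auto
      then show ?thesis using kl \<open>i \<le> j\<close> by simp
    qed
  qed
qed

lemma coords_surj:
  assumes "length xs = CARD('n::{finite,linorder})"
  obtains a :: "real^'n::{finite,linorder}" where "coords a = xs"
proof
  let ?is = "sorted_list_of_set (UNIV :: 'n set)"
  show "coords (\<chi> i. the (map_of (zip ?is xs) i) :: real^'n::{finite,linorder}) = xs"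
    unfolding coords_def using assms by (intro nth_equalityI) (auto simp: map_of_zip_nth)
qed

text \<open>Ends are kept as ordered pairs, lower before upper, to match the pairs of lists.\<close>

definition edge_ends :: "((real^'n::{finite,linorder}) \<times> (real^'n::{finite,linorder})) set" where
  "edge_ends = {(threshold_degrees a {}, threshold_degrees a UNIV) | a. antimono (\<lambda>i. a $ i) \<and> (\<exists>v. resonance a = {v})}"

lemma coords_edge_ends:
  "map_prod coords coords ` (edge_ends :: ((real^'n::{finite,linorder}) \<times> _) set) = edge_pairs CARD('n)"
proof (intro equalityI subsetI)
  fix e assume "e \<in> map_prod coords coords ` (edge_ends :: ((real^'n::{finite,linorder}) \<times> _) set)"
  then obtain a :: "real^'n::{finite,linorder}" and v where a: "antimono (\<lambda>i. a $ i)" "resonance a = {v}"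
    and e: "e = (coords (threshold_degrees a {}), coords (threshold_degrees a UNIV))"
    by (auto simp: edge_ends_def)
  then show "e \<in> edge_pairs CARD('n)"
    using lower_upper_degrees_single_resonance[of "coords a" v]
    by (simp add: coords_lower_degrees coords_upper_degrees sorted_coords resonances_coords length_coords)
next
  fix e assume e: "e \<in> edge_pairs CARD('n)"
  obtain l u where lu: "e = (l, u)" by (cases e)
  then obtain xs v where xs: "realizes xs l u {v}" using edge_pairs_realizable e by blast
  then have "length xs = CARD('n)" using edge_pairs_length e lu realizes_length by metis
  then obtain a :: "real^'n::{finite,linorder}" where a: "coords a = xs" by (rule coords_surj)
  then have "antimono (\<lambda>i. a $ i)" "resonance a = {v}"
    using xs by (auto simp: realizes_def simp flip: sorted_coords resonances_coords)
  then have "(threshold_degrees a {}, threshold_degrees a UNIV) \<in> edge_ends" by (auto simp: edge_ends_def)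
  moreover have "e = map_prod coords coords (threshold_degrees a {}, threshold_degrees a UNIV)"
    using lu xs a by (simp add: coords_lower_degrees coords_upper_degrees realizes_def)
  ultimately show "e \<in> map_prod coords coords ` (edge_ends :: ((real^'n::{finite,linorder}) \<times> _) set)"
    by blast
qed

lemma edges_DP:
  "{e. e edge_of (DP :: (real^'n::{finite,linorder}) set)} = (\<lambda>(l, u). closed_segment l u) ` edge_ends"
  using resonance_imp_edge by (auto simp: edge_ends_def elim!: edge_imp_resonance)

text \<open>A segment determines its ends up to order, and the componentwise order tells which of
  them is the lower one.\<close>

lemma inj_on_segment: "inj_on (\<lambda>(l, u). closed_segment l u) edge_ends"
proof (rule inj_onI)
  fix e f :: "(real^'n::{finite,linorder}) \<times> (real^'n::{finite,linorder})"
  assume "e \<in> edge_ends" "f \<in> edge_ends"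
    and eq: "(case e of (l, u) \<Rightarrow> closed_segment l u) = (case f of (l, u) \<Rightarrow> closed_segment l u)"
  then have "fst e \<le> snd e" "fst f \<le> snd f"
    using threshold_degrees_le by (auto simp: edge_ends_def)
  moreover have "{fst e, snd e} = {fst f, snd f}"
    using eq by (simp add: case_prod_beta closed_segment_eq)
  ultimately show "e = f"
    by (metis doubleton_eq_iff order_antisym prod.collapse)
qed

theorem theorem5p4:
  assumes "CARD('n::{finite,linorder}) \<ge> 3"
  shows "card {e. e edge_of (DP :: (real ^ 'n::{finite,linorder}) set)}
    = 2 ^ (CARD('n::{finite,linorder}) - 2) * (2 * CARD('n::{finite,linorder}) - 3)"
proof -
  let ?E = "edge_ends :: ((real^'n::{finite,linorder}) \<times> (real^'n::{finite,linorder})) set"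
  have "card {e. e edge_of (DP :: (real ^ 'n::{finite,linorder}) set)} = card ?E"
    unfolding edges_DP by (rule card_image[OF inj_on_segment])
  also have "\<dots> = card (map_prod coords coords ` ?E)"
    by (intro card_image[symmetric] inj_on_subset[OF prod.inj_map subset_UNIV] inj_coords)
  also have "\<dots> = card (edge_pairs CARD('n))"
    by (simp only: coords_edge_ends)
  also have "\<dots> = 2 ^ (CARD('n) - 2) * (2 * CARD('n) - 3)"
  proof -
    obtain k where "CARD('n) = k + 2" using assms by (metis add.commute le_Suc_ex numeral_3_eq_3 le_trans Suc_leD numeral_2_eq_2)
    then show ?thesis using card_edge_pairs[of k] by simp
  qed
  finally show ?thesis .
qed

end
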